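(* Let $k\ge 2$ be an integer, let $G$ be a $k$-edge-connected graph, and let $H$ be a minimum $k$-edge-connected spanning subgraph of $G$. Then $umc_k(G)=e(G)-e(H)+1$.
   Context: All graphs are finite, simple and undirected; $e(G)$ denotes the number of edges of $G$. A $k$-edge-connected graph has at least two vertices, and every two distinct vertices are joined by at least $k$ edge-disjoint paths. A minimum $k$-edge-connected spanning subgraph of $G$ is a $k$-edge-connected spanning subgraph of $G$ with the minimum number of edges. An edge-coloring assigns to each edge a color, where adjacent edges may receive the same color. For a $k$-edge-connected graph $G$, a $UMC_k$-coloring of $G$ is an edge-coloring such that for every two distinct vertices $u,v$ of $G$ there are at least $k$ pairwise edge-disjoint $uv$-paths all of whose edges (over all $k$ paths) have one and the same color; this color may depend on the pair $u,v$. The uniformly monochromatic $k$-edge-connection number $umc_k(G)$ is the maximum number of colors actually used by a $UMC_k$-coloring of $G$. *)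

theory Defs
  imports Main
begin

record 'a ugraph =
  verts :: "'a set"
  edges :: "'a set set"

definition simple_graph :: "'a ugraph \<Rightarrow> bool" where
  "simple_graph G \<longleftrightarrow> finite (verts G) \<and> (\<forall>e\<in>edges G. e \<subseteq> verts G \<and> card e = 2)"

text \<open>A path is given by the list of its successive vertices.\<close>

fun path_edges :: "'a list \<Rightarrow> 'a set set" where
  "path_edges [] = {}"
| "path_edges [x] = {}"
| "path_edges (x # y # xs) = insert {x, y} (path_edges (y # xs))"

definition is_path :: "'a ugraph \<Rightarrow> 'a \<Rightarrow> 'a \<Rightarrow> 'a list \<Rightarrow> bool" where
  "is_path G u v p \<longleftrightarrow>
     p \<noteq> [] \<and> distinct p \<and> hd p = u \<and> last p = v \<and>
     set p \<subseteq> verts G \<and> path_edges p \<subseteq> edges G"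

text \<open>
  A family of pairwise edge-disjoint paths between two distinct vertices can be taken as a set:
  each such path has an edge, so a repeated path would not be edge-disjoint from itself.
\<close>

definition edge_disjoint_paths :: "'a ugraph \<Rightarrow> 'a \<Rightarrow> 'a \<Rightarrow> 'a list set \<Rightarrow> bool" where
  "edge_disjoint_paths G u v P \<longleftrightarrow>
     finite P \<and> (\<forall>p\<in>P. is_path G u v p) \<and>
     pairwise (\<lambda>p q. disjnt (path_edges p) (path_edges q)) P"

definition edge_connected :: "nat \<Rightarrow> 'a ugraph \<Rightarrow> bool" where
  "edge_connected k G \<longleftrightarrow>
     simple_graph G \<and> card (verts G) \<ge> 2 \<and>
     (\<forall>u\<in>verts G. \<forall>v\<in>verts G. u \<noteq> v \<longrightarrow>
        (\<exists>P. edge_disjoint_paths G u v P \<and> card P \<ge> k))"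

definition spanning_subgraph :: "'a ugraph \<Rightarrow> 'a ugraph \<Rightarrow> bool" where
  "spanning_subgraph H G \<longleftrightarrow> verts H = verts G \<and> edges H \<subseteq> edges G"

definition min_edge_connected_spanning_subgraph ::
    "nat \<Rightarrow> 'a ugraph \<Rightarrow> 'a ugraph \<Rightarrow> bool" where
  "min_edge_connected_spanning_subgraph k G H \<longleftrightarrow>
     is_arg_min (\<lambda>H'. card (edges H')) (\<lambda>H'. spanning_subgraph H' G \<and> edge_connected k H') H"

text \<open>
  Colors are natural numbers, which suffices because the edge set is finite; values of a
  coloring outside the edge set play no role.
\<close>

definition umc_coloring :: "nat \<Rightarrow> 'a ugraph \<Rightarrow> ('a set \<Rightarrow> nat) \<Rightarrow> bool" where
  "umc_coloring k G c \<longleftrightarrow>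
     (\<forall>u\<in>verts G. \<forall>v\<in>verts G. u \<noteq> v \<longrightarrow>
        (\<exists>P col. edge_disjoint_paths G u v P \<and> card P \<ge> k \<and>
                 (\<forall>p\<in>P. \<forall>e\<in>path_edges p. c e = col)))"

text \<open>
  For finite edge sets the set below is bounded by the number of edges, and for
  \<open>k\<close>-edge-connected \<open>G\<close> it contains the value of a constant coloring, so the maximum exists.
\<close>

definition umc :: "nat \<Rightarrow> 'a ugraph \<Rightarrow> nat" where
  "umc k G = Max {card (c ` edges G) | c. umc_coloring k G c}"

end

theory Submission
  imports Defs
begin

text \<open>
  For the lower bound, give \<open>H\<close> one color and every other edge a color of its own. For the upper
  bound, call two vertices \<open>i\<close>-linked if every cut separating them contains at least \<open>k\<close> edges of
  color \<open>i\<close>; every pair is linked in some color. Let \<open>I\<close> be a minimal set of colors whose links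
  cross every cut of the vertex set. By Menger the edges with colors in \<open>I\<close> form a
  \<open>k\<close>-edge-connected spanning subgraph, so there are at least \<open>e(H)\<close> of them. Discard one edge from
  each remaining color class and let \<open>W\<close> be the edges that are left; it is enough to show
  \<open>|I| \<le> |W| + 1\<close>.

  By minimality each \<open>j \<in> I\<close> has a cut \<open>S j\<close> crossed by \<open>j\<close>-links but by no other link in \<open>I\<close>. Give
  a vertex \<open>v\<close> the trace \<open>{j \<in> I. v \<in> S j}\<close>. There are at least \<open>|I| + 1\<close> traces. Vertices
  linked in a color of \<open>I\<close> have traces differing in at most one element, so vertices whose traces
  differ in two elements are linked in a color outside \<open>I\<close>, hence (as \<open>k \<ge> 2\<close>) connected in \<open>W\<close>.
  Since two traces at distance two have exactly two common neighbors, which are again at distance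
  two, \<open>W\<close> together with one extra edge connects all the traces; hence \<open>|I| + 1 \<le> |W| + 2\<close>.
\<close>

section \<open>Counting edges through traces\<close>

text \<open>As when growing a spanning tree: starting from one vertex, each vertex added across a
  crossed cut brings an edge of \<open>W\<close> that was not inside the earlier set.\<close>

lemma connected_card_le:
  fixes V :: "'b set"
  assumes "finite V" "finite W"
    and cross: "\<And>T. T \<subseteq> V \<Longrightarrow> T \<noteq> {} \<Longrightarrow> T \<noteq> V \<Longrightarrow> \<exists>x\<in>T. \<exists>y\<in>V - T. {x, y} \<in> W"
  shows "card V \<le> card W + 1"
proof (cases "V = {}")
  case False
  have "\<exists>T\<subseteq>V. card T = n \<and> card T \<le> card {e \<in> W. e \<subseteq> T} + 1" if "1 \<le> n" "n \<le> card V" for n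
    using that
  proof (induction n rule: nat_induct_at_least)
    case base
    obtain v where "v \<in> V" using False by blast
    then show ?case by (intro exI[of _ "{v}"]) auto
  next
    case (Suc n)
    then obtain T where T: "T \<subseteq> V" "card T = n" "card T \<le> card {e \<in> W. e \<subseteq> T} + 1"
      by auto
    have "T \<noteq> {}" "T \<noteq> V" using T Suc by auto
    then obtain x y where xy: "x \<in> T" "y \<in> V - T" "{x, y} \<in> W" using cross T(1) by blast
    have fT: "finite T" using T(1) assms(1) finite_subset by blast
    have "card (insert {x, y} {e \<in> W. e \<subseteq> T}) \<le> card {e \<in> W. e \<subseteq> insert y T}"
      using xy assms(2) by (intro card_mono) auto
    moreover have "card (insert {x, y} {e \<in> W. e \<subseteq> T}) = Suc (card {e \<in> W. e \<subseteq> T})"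
      using xy assms(2) by (subst card_insert_disjoint) auto
    ultimately show ?case
      using T xy fT by (intro exI[of _ "insert y T"]) auto
  qed
  from this[of "card V"] obtain T
    where T: "T \<subseteq> V" "card T = card V" "card T \<le> card {e \<in> W. e \<subseteq> T} + 1"
    using False assms(1) by (metis card_gt_0_iff less_eq_Suc_le One_nat_def order_refl)
  moreover have "card {e \<in> W. e \<subseteq> T} \<le> card W" using assms(2) by (intro card_mono) auto
  ultimately show ?thesis by linarith
qed auto

text \<open>Hamming distance at least two, given by two witnesses so that no cardinalities
  enter.\<close>

definition far :: "'b set \<Rightarrow> 'b set \<Rightarrow> bool" where
  "far A B \<longleftrightarrow> (\<exists>i j. i \<noteq> j \<and> (i \<in> A \<longleftrightarrow> i \<notin> B) \<and> (j \<in> A \<longleftrightarrow> j \<notin> B))"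

text \<open>On two elements where \<open>p\<close> and \<open>q\<close> differ, a set near both
  follows \<open>p\<close> on one and \<open>q\<close> on the other, and elsewhere it agrees with
  both. The two candidates differ on both elements, so candidates near each other coincide.\<close>

lemma common_near_unique:
  assumes "far p q" "\<not> far p r" "\<not> far q r" "\<not> far p s" "\<not> far q s" "\<not> far r s"
  shows "r = s"
proof (rule ccontr)
  assume "r \<noteq> s"
  then obtain m where m: "m \<in> r \<longleftrightarrow> m \<notin> s" by blast
  obtain i j where ij: "i \<noteq> j" "i \<in> p \<longleftrightarrow> i \<notin> q" "j \<in> p \<longleftrightarrow> j \<notin> q"
    using assms(1) unfolding far_def by blast
  have n: "(a \<in> x \<longleftrightarrow> a \<in> y) \<or> (b \<in> x \<longleftrightarrow> b \<in> y)" if "\<not> far x y" "a \<noteq> b" for x y :: "'a set" and a b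
    using that unfolding far_def by blast
  note N = assms(2-6)[THEN n]
  consider "m = i" | "m = j" | "m \<noteq> i" "m \<noteq> j" by blast
  then show False
  proof cases
    case 1
    then show False using N[OF ij(1)] ij(2,3) m unfolding 1 by sat
  next
    case 2
    then show False using N[OF ij(1)] ij(2,3) m unfolding 2 by sat
  next
    case 3
    then show False using N[OF ij(1)] N[OF 3(1)] N[OF 3(2)] ij(2,3) m by sat
  qed
qed

text \<open>Forgetting the coordinate \<open>j\<close> merges two traces that differ in
  \<open>j\<close> alone, so every coordinate accounts for at least one further trace.\<close>

lemma card_traces_ge:
  assumes "finite J" "finite V" "V \<noteq> {}"
    and "\<And>j. j \<in> J \<Longrightarrow> \<exists>x\<in>V. \<exists>y\<in>V. \<forall>i\<in>J. (x \<in> S i \<longleftrightarrow> y \<notin> S i) \<longleftrightarrow> i = j"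
  shows "card J + 1 \<le> card ((\<lambda>v. {j \<in> J. v \<in> S j}) ` V)"
  using assms(1,4)
proof (induction J rule: finite_induct)
  case empty
  then show ?case using assms(2,3) by (simp add: card_gt_0_iff Suc_le_eq)
next
  case (insert j J)
  let ?t = "\<lambda>J v. {j \<in> J. v \<in> S j}"
  have "card J + 1 \<le> card (?t J ` V)"
  proof (rule insert.IH)
    fix l assume "l \<in> J"
    then obtain x y where "x \<in> V" "y \<in> V"
      "\<forall>i\<in>insert j J. (x \<in> S i \<longleftrightarrow> y \<notin> S i) \<longleftrightarrow> i = l"
      using insert.prems[of l] by auto
    then show "\<exists>x\<in>V. \<exists>y\<in>V. \<forall>i\<in>J. (x \<in> S i \<longleftrightarrow> y \<notin> S i) \<longleftrightarrow> i = l"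
      by (intro bexI[of _ x] bexI[of _ y]) simp_all
  qed
  moreover have "card (?t J ` V) < card (?t (insert j J) ` V)"
  proof -
    obtain x y where xy: "x \<in> V" "y \<in> V"
      "\<forall>i\<in>insert j J. (x \<in> S i \<longleftrightarrow> y \<notin> S i) \<longleftrightarrow> i = j"
      using insert.prems[of j] by auto
    have im: "?t J ` V = (\<lambda>A. A \<inter> J) ` (?t (insert j J) ` V)"
      unfolding image_image using insert.hyps by (intro image_cong) auto
    have eq: "?t (insert j J) x \<inter> J = ?t (insert j J) y \<inter> J" using xy insert.hyps by auto
    have ne: "?t (insert j J) x \<noteq> ?t (insert j J) y" using xy by auto
    have "\<not> inj_on (\<lambda>A. A \<inter> J) (?t (insert j J) ` V)"
      using eq ne xy(1,2) unfolding inj_on_def by blast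
    then show ?thesis
      unfolding im using assms(2)
      by (meson card_image_le eq_card_imp_inj_on finite_imageI le_neq_implies_less)
  qed
  ultimately show ?case using insert.hyps by simp
qed

text \<open>Identifying vertices of equal trace turns \<open>W\<close> into a graph on the traces.
  At most one more edge makes it connected, so there are at most \<open>card W + 2\<close> traces,
  against at least \<open>card J + 1\<close>.\<close>

lemma critical_family_card_le:
  assumes "finite J" "finite V" "V \<noteq> {}" "finite W"
    and sep: "\<And>j. j \<in> J \<Longrightarrow> \<exists>x\<in>V. \<exists>y\<in>V. \<forall>i\<in>J. (x \<in> S i \<longleftrightarrow> y \<notin> S i) \<longleftrightarrow> i = j"
    and cross: "\<And>T x y. x \<in> V \<inter> T \<Longrightarrow> y \<in> V - T \<Longrightarrow> far {j \<in> J. x \<in> S j} {j \<in> J. y \<in> S j} \<Longrightarrow>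
      \<exists>a\<in>V \<inter> T. \<exists>b\<in>V - T. {a, b} \<in> W"
  shows "card J \<le> card W + 1"
proof (cases "card J \<le> 1")
  case False
  define t where "t v = {j \<in> J. v \<in> S j}" for v
  define D where "D = t ` V"
  \<comment> \<open>Edges between vertices of equal trace become singletons. They are harmless, as
    only an upper bound on \<open>card W'\<close> is used.\<close>
  define W' where "W' = (`) t ` W"
  have D: "card J + 1 \<le> card D"
    using card_traces_ge[OF assms(1-3) sep] unfolding D_def t_def by blast
  have fin: "finite D" "finite W'" unfolding D_def W'_def using assms(2,4) by auto
  have W': "card W' \<le> card W" unfolding W'_def using assms(4) by (rule card_image_le)
  obtain j l where jl: "j \<in> J" "l \<in> J" "j \<noteq> l"
    using False assms(1) by (metis One_nat_def card_le_Suc0_iff_eq)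
  have cross': "\<exists>a\<in>T. \<exists>b\<in>D - T. {a, b} \<in> W'"
    if TD: "T \<subseteq> D" "A \<in> T" "B \<in> D - T" "far A B" for T A B
  proof -
    obtain x y where xy: "x \<in> V" "A = t x" "y \<in> V" "B = t y" using TD unfolding D_def by blast
    obtain a b where "a \<in> V \<inter> {v. t v \<in> T}" "b \<in> V - {v. t v \<in> T}" "{a, b} \<in> W"
      using cross[of x "{v. t v \<in> T}" y] xy TD unfolding t_def by auto
    then show ?thesis
      unfolding D_def W'_def by (intro bexI[of _ "t a"] bexI[of _ "t b"]) (auto simp: image_iff intro!: bexI[of _ "{a, b}"])
  qed
  \<comment> \<open>Below, \<open>x\<close> and \<open>y\<close> differ in \<open>j\<close> but
    agree in \<open>l\<close>, and \<open>z\<close> and \<open>w\<close> do the opposite. Hence one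
    of \<open>x\<close>, \<open>y\<close> differs from one of \<open>z\<close>, \<open>w\<close> in
    both.\<close>
  have "\<exists>p\<in>D. \<exists>q\<in>D. far p q"
  proof (rule ccontr)
    assume near: "\<not> ?thesis"
    obtain x y where xy: "x \<in> V" "y \<in> V" "\<forall>i\<in>J. (x \<in> S i \<longleftrightarrow> y \<notin> S i) \<longleftrightarrow> i = j"
      using sep[OF jl(1)] by auto
    obtain z w where zw: "z \<in> V" "w \<in> V" "\<forall>i\<in>J. (z \<in> S i \<longleftrightarrow> w \<notin> S i) \<longleftrightarrow> i = l"
      using sep[OF jl(2)] by auto
    have n: "(j \<in> t a \<longleftrightarrow> j \<in> t b) \<or> (l \<in> t a \<longleftrightarrow> l \<in> t b)" if "a \<in> V" "b \<in> V" for a b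
    proof -
      have "\<not> far (t a) (t b)" using near that unfolding D_def by blast
      then show ?thesis using jl(3) unfolding far_def by blast
    qed
    show False
      using n[of x z] n[of x w] n[of y z] n[of y w] xy zw jl unfolding t_def by auto
  qed
  then obtain p q where pq: "p \<in> D" "q \<in> D" "far p q" by blast
  have flip: "\<exists>a\<in>D - T. \<exists>b\<in>D - (D - T). {a, b} \<in> X \<Longrightarrow> T \<subseteq> D \<Longrightarrow> \<exists>a\<in>T. \<exists>b\<in>D - T. {a, b} \<in> X" for T X
    by (metis Diff_iff double_diff insert_commute subset_refl)
  \<comment> \<open>Either \<open>W'\<close> already connects the traces, or an uncrossed set
    \<open>U\<close> contains \<open>p\<close> and misses a trace \<open>r\<close>; then
    \<open>{p, r}\<close> is the extra edge.\<close>
  have "card D \<le> card W' + 2"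
  proof (cases "\<exists>T\<subseteq>D. p \<in> T \<and> T \<noteq> D \<and> \<not> (\<exists>a\<in>T. \<exists>b\<in>D - T. {a, b} \<in> W')")
    case False
    have "card D \<le> card W' + 1"
    proof (rule connected_card_le[OF fin])
      fix T assume T: "T \<subseteq> D" "T \<noteq> {}" "T \<noteq> D"
      show "\<exists>a\<in>T. \<exists>b\<in>D - T. {a, b} \<in> W'"
      proof (cases "p \<in> T")
        case True
        then show ?thesis using False T by blast
      next
        case pT: False
        have "D - T \<subseteq> D" "p \<in> D - T" "D - T \<noteq> D" using T pT pq by auto
        with False have "\<exists>a\<in>D - T. \<exists>b\<in>D - (D - T). {a, b} \<in> W'" by blast
        from flip[OF this T(1)] show ?thesis .
      qed
    qed
    then show ?thesis by simp
  next
    case True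
    then obtain U where U: "U \<subseteq> D" "p \<in> U" "U \<noteq> D" "\<not> (\<exists>a\<in>U. \<exists>b\<in>D - U. {a, b} \<in> W')" by blast
    then obtain r where r: "r \<in> D" "r \<notin> U" by blast
    \<comment> \<open>An uncrossed cut never separates far traces.\<close>
    have qU: "q \<in> U" using cross'[OF U(1,2), of q] U(4) pq by blast
    have rn: "\<not> far p r" "\<not> far q r" using cross'[OF U(1)] U(2,4) qU r by blast+
    \<comment> \<open>Another uncrossed cut would keep \<open>p\<close>, \<open>q\<close>,
      \<open>r\<close> together, and a trace \<open>s\<close> across it would be near all three,
      which forces \<open>s = r\<close>.\<close>
    have main: "\<exists>a\<in>T. \<exists>b\<in>D - T. {a, b} \<in> insert {p, r} W'" if T: "T \<subseteq> D" "p \<in> T" "T \<noteq> D" for T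
    proof (rule ccontr)
      assume no: "\<not> ?thesis"
      obtain s where s: "s \<in> D" "s \<notin> T" using T by blast
      have rT: "r \<in> T" using no T(2) r by blast
      have qT: "q \<in> T" using cross'[OF T(1,2), of q] no pq by blast
      have "\<not> far p s" "\<not> far q s" "\<not> far r s" using cross'[OF T(1)] no s rT qT T(2) by blast+
      then have "r = s" using common_near_unique[OF pq(3) rn] by blast
      then show False using rT s by blast
    qed
    have "card D \<le> card (insert {p, r} W') + 1"
    proof (rule connected_card_le)
      fix T assume T: "T \<subseteq> D" "T \<noteq> {}" "T \<noteq> D"
      show "\<exists>a\<in>T. \<exists>b\<in>D - T. {a, b} \<in> insert {p, r} W'"
      proof (cases "p \<in> T")
        case True
        then show ?thesis using main T by blast
      next
        case pT: False
        have "D - T \<subseteq> D" "p \<in> D - T" "D - T \<noteq> D" using T pT pq by auto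
        from flip[OF main[OF this] T(1)] show ?thesis .
      qed
    qed (use fin in auto)
    then show ?thesis using card_insert_le_m1[of "Suc (card W')" W' "{p, r}"] by simp
  qed
  then show ?thesis using D W' by linarith
qed simp

section \<open>Cuts and Menger's theorem for edges\<close>

definition cut :: "'a set set \<Rightarrow> 'a set \<Rightarrow> 'a set set" where
  "cut F S = {e \<in> F. e \<inter> S \<noteq> {} \<and> \<not> e \<subseteq> S}"

lemma finite_cut: "finite F \<Longrightarrow> finite (cut F S)"
  unfolding cut_def by simp

lemma path_crosses_cut:
  assumes "p \<noteq> []" "hd p \<in> S" "last p \<notin> S"
  shows "\<exists>e\<in>path_edges p. e \<inter> S \<noteq> {} \<and> \<not> e \<subseteq> S"
  using assms
proof (induction p rule: path_edges.induct)
  case (3 x y xs)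
  then show ?case by (cases "y \<in> S") auto
qed auto

text \<open>The easy half of Menger: each path has an edge in the cut, and disjointness makes the
  choice injective.\<close>

lemma card_paths_le_card_cut:
  assumes P: "edge_disjoint_paths G u v P" and F: "finite F" "\<And>p. p \<in> P \<Longrightarrow> path_edges p \<subseteq> F"
    and S: "u \<in> S" "v \<notin> S"
  shows "card P \<le> card (cut F S)"
proof -
  have "\<exists>e. e \<in> path_edges p \<and> e \<inter> S \<noteq> {} \<and> \<not> e \<subseteq> S" if "p \<in> P" for p
  proof -
    have "is_path G u v p" using P that unfolding edge_disjoint_paths_def by blast
    then show ?thesis using path_crosses_cut[of p S] S unfolding is_path_def by blast
  qed
  then obtain f where f: "\<And>p. p \<in> P \<Longrightarrow> f p \<in> path_edges p \<and> f p \<inter> S \<noteq> {} \<and> \<not> f p \<subseteq> S"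
    using bchoice[of P "\<lambda>p e. e \<in> path_edges p \<and> e \<inter> S \<noteq> {} \<and> \<not> e \<subseteq> S"] by blast
  have "inj_on f P"
  proof (rule inj_onI, rule ccontr)
    fix p q assume pq: "p \<in> P" "q \<in> P" "f p = f q" "p \<noteq> q"
    then have "disjnt (path_edges p) (path_edges q)"
      using P unfolding edge_disjoint_paths_def pairwise_def by blast
    then show False using f[OF pq(1)] f[OF pq(2)] pq(3) unfolding disjnt_def by auto
  qed
  moreover have "f ` P \<subseteq> cut F S" using f F(2) unfolding cut_def by blast
  ultimately show ?thesis using finite_cut[OF F(1)] by (rule card_inj_on_le)
qed

section \<open>Vertex lists as directed paths\<close>

fun arcs :: "'a list \<Rightarrow> ('a \<times> 'a) set" where
  "arcs [] = {}"
| "arcs [x] = {}"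
| "arcs (x # y # xs) = insert (x, y) (arcs (y # xs))"

lemma arcs_subset_Times: "arcs p \<subseteq> set p \<times> set p"
  by (induction p rule: arcs.induct) auto

lemma set_subset_if_arcs: "arcs p \<subseteq> A \<times> A \<Longrightarrow> p \<noteq> [] \<Longrightarrow> hd p \<in> A \<Longrightarrow> set p \<subseteq> A"
  by (induction p rule: arcs.induct) auto

lemma arcs_append_subset: "arcs ys \<subseteq> arcs (xs @ ys)"
proof (induction xs)
  case (Cons x xs)
  then show ?case by (cases "xs @ ys") auto
qed simp

lemma path_edges_eq_arcs: "path_edges p = (\<lambda>(a, b). {a, b}) ` arcs p"
  by (induction p rule: arcs.induct) auto

text \<open>If the vertex to be prepended already occurs, the suffix starting there is a distinct
  list with the right ends.\<close>

lemma rtrancl_imp_distinct_list: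
  assumes "(u, v) \<in> r\<^sup>*"
  shows "\<exists>p. p \<noteq> [] \<and> distinct p \<and> hd p = u \<and> last p = v \<and> arcs p \<subseteq> r"
  using assms
proof (induction rule: converse_rtrancl_induct)
  case base
  show ?case by (intro exI[of _ "[v]"]) simp
next
  case (step u w)
  then obtain p where p: "p \<noteq> []" "distinct p" "hd p = w" "last p = v" "arcs p \<subseteq> r" by blast
  show ?case
  proof (cases "u \<in> set p")
    case True
    then obtain xs ys where "p = xs @ u # ys" by (meson split_list)
    then show ?thesis
      using p arcs_append_subset[of "u # ys" xs] by (intro exI[of _ "u # ys"]) auto
  next
    case False
    then show ?thesis
      using p step.hyps(1) by (intro exI[of _ "u # p"]) (cases p; auto)
  qed
qed

section \<open>Unit flows: augmentation, cuts and decomposition into paths\<close>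

definition path_flow :: "'a list \<Rightarrow> 'a \<Rightarrow> 'a \<Rightarrow> int" where
  "path_flow p a b = of_bool ((a, b) \<in> arcs p) - of_bool ((b, a) \<in> arcs p)"

lemma sum_path_flow:
  assumes "distinct p" "p \<noteq> []" "set p \<subseteq> V" "finite V"
  shows "(\<Sum>b\<in>V. path_flow p a b) = of_bool (a = hd p) - of_bool (a = last p)"
  using assms
proof (induction p rule: arcs.induct)
  case (3 x y xs)
  \<comment> \<open>Since \<open>x\<close> does not recur in \<open>y # xs\<close>, no arc of the
    tail involves \<open>x\<close>, and the contributions simply add. The leading arc moves the
    source from \<open>y\<close> to \<open>x\<close>.\<close>
  have "path_flow (x # y # xs) a b =
      of_bool (a = x) * of_bool (b = y) - of_bool (a = y) * of_bool (b = x) + path_flow (y # xs) a b" for b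
    using 3(2) arcs_subset_Times[of "y # xs"] unfolding path_flow_def by auto
  moreover have "(\<Sum>b\<in>V. of_bool (b = z)) = (1::int)" if "z \<in> V" for z
    using that 3(5) by (simp add: of_bool_def sum.delta)
  ultimately show ?case
    using 3 by (simp add: sum.distrib sum_subtractf flip: sum_distrib_left)
qed (auto simp: path_flow_def)

text \<open>Undirected unit-capacity flows are antisymmetric functions bounded by 1.\<close>

definition unit_flow :: "'a set \<Rightarrow> 'a set set \<Rightarrow> 'a \<Rightarrow> 'a \<Rightarrow> nat \<Rightarrow> ('a \<Rightarrow> 'a \<Rightarrow> int) \<Rightarrow> bool" where
  "unit_flow V E u v n g \<longleftrightarrow>
     (\<forall>a b. g a b = - g b a) \<and> (\<forall>a b. g a b \<le> 1) \<and> (\<forall>a b. g a b \<noteq> 0 \<longrightarrow> {a, b} \<in> E) \<and>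
     (\<forall>a\<in>V. (\<Sum>b\<in>V. g a b) = int n * (of_bool (a = u) - of_bool (a = v)))"

lemma unit_flowD:
  assumes "unit_flow V E u v n g"
  shows "g a b = - g b a" "g a b \<le> 1" "g a b \<noteq> 0 \<Longrightarrow> {a, b} \<in> E"
    and "a \<in> V \<Longrightarrow> (\<Sum>b\<in>V. g a b) = int n * (of_bool (a = u) - of_bool (a = v))"
  using assms unfolding unit_flow_def by blast+

text \<open>Augmentation along a residual path: where \<open>g\<close> is 0 an edge comes into use,
  and where it is -1 an opposite unit is cancelled.\<close>

lemma unit_flow_add_path:
  assumes g: "unit_flow V E u v n g" and V: "finite V"
    and p: "p \<noteq> []" "distinct p" "hd p = u" "last p = v" "set p \<subseteq> V"
    and arcs: "arcs p \<subseteq> {(a, b). {a, b} \<in> E \<and> g a b < 1}"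
  shows "unit_flow V E u v (Suc n) (\<lambda>a b. g a b + path_flow p a b)"
  unfolding unit_flow_def
proof (intro conjI allI ballI impI)
  fix a b
  note anti = unit_flowD(1)[OF g]
  note le = unit_flowD(2)[OF g]
  show "g a b + path_flow p a b = - (g b a + path_flow p b a)"
    using anti[of a b] unfolding path_flow_def by simp
  show "g a b + path_flow p a b \<le> 1"
    using le[of a b] arcs unfolding path_flow_def by (auto simp: of_bool_def)
  assume nz: "g a b + path_flow p a b \<noteq> 0"
  show "{a, b} \<in> E"
  proof (cases "g a b = 0")
    case True
    then have "(a, b) \<in> arcs p \<or> (b, a) \<in> arcs p"
      using nz unfolding path_flow_def by (auto simp: of_bool_def split: if_splits)
    then show ?thesis using arcs by (auto simp: insert_commute)
  next
    case False
    then show ?thesis using unit_flowD(3)[OF g] by blast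
  qed
next
  fix a assume "a \<in> V"
  then show "(\<Sum>b\<in>V. g a b + path_flow p a b) = int (Suc n) * (of_bool (a = u) - of_bool (a = v))"
    using unit_flowD(4)[OF g \<open>a \<in> V\<close>] sum_path_flow[OF p(2,1,5) V, of a] p(3,4)
    by (simp add: sum.distrib algebra_simps)
qed

text \<open>The arcs of \<open>p\<close> carry a full unit, so subtraction clears its edges in both
  directions. The second claim makes paths extracted later edge-disjoint from
  \<open>p\<close>.\<close>

lemma unit_flow_remove_path:
  assumes g: "unit_flow V E u v (Suc n) g" and V: "finite V"
    and p: "p \<noteq> []" "distinct p" "hd p = u" "last p = v" "set p \<subseteq> V"
    and arcs: "arcs p \<subseteq> {(a, b). g a b = 1}"
  shows "unit_flow V E u v n (\<lambda>a b. g a b - path_flow p a b)"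
    and "g a b - path_flow p a b = 1 \<Longrightarrow> g a b = 1 \<and> (a, b) \<notin> arcs p \<and> (b, a) \<notin> arcs p"
proof -
  note anti = unit_flowD(1)[OF g]
  note le = unit_flowD(2)[OF g]
  have diff: "g a b - path_flow p a b = (if (a, b) \<in> arcs p \<or> (b, a) \<in> arcs p then 0 else g a b)" for a b
  proof -
    have "(a, b) \<in> arcs p \<Longrightarrow> g a b = 1" "(b, a) \<in> arcs p \<Longrightarrow> g b a = 1" using arcs by auto
    then show ?thesis using anti[of a b] unfolding path_flow_def by auto
  qed
  show "g a b - path_flow p a b = 1 \<Longrightarrow> g a b = 1 \<and> (a, b) \<notin> arcs p \<and> (b, a) \<notin> arcs p"
    unfolding diff by (simp split: if_splits)
  show "unit_flow V E u v n (\<lambda>a b. g a b - path_flow p a b)"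
    unfolding unit_flow_def
  proof (intro conjI allI ballI impI)
    fix a b
    show "g a b - path_flow p a b = - (g b a - path_flow p b a)"
      using anti[of a b] unfolding path_flow_def by simp
    show "g a b - path_flow p a b \<le> 1" unfolding diff using le by simp
    assume "g a b - path_flow p a b \<noteq> 0"
    then have "g a b \<noteq> 0" unfolding diff by (simp split: if_splits)
    then show "{a, b} \<in> E" by (rule unit_flowD(3)[OF g])
  next
    fix a assume "a \<in> V"
    then show "(\<Sum>b\<in>V. g a b - path_flow p a b) = int n * (of_bool (a = u) - of_bool (a = v))"
      using unit_flowD(4)[OF g \<open>a \<in> V\<close>] sum_path_flow[OF p(2,1,5) V, of a] p(3,4)
      by (simp add: sum_subtractf algebra_simps)
  qed
qed

text \<open>Summing conservation over \<open>S\<close>, only the source contributes, and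
  antisymmetry cancels the flow inside \<open>S\<close>.\<close>

lemma unit_flow_across_cut:
  assumes g: "unit_flow V E u v n g" and V: "finite V" and S: "S \<subseteq> V" "u \<in> S" "v \<notin> S"
  shows "(\<Sum>a\<in>S. \<Sum>b\<in>V - S. g a b) = int n"
proof -
  note anti = unit_flowD(1)[OF g]
  have fS: "finite S" using S V finite_subset by blast
  have "(\<Sum>a\<in>S. \<Sum>b\<in>S. g a b) = (\<Sum>a\<in>S. \<Sum>b\<in>S. - g b a)"
    by (intro sum.cong refl anti)
  also have "\<dots> = - (\<Sum>b\<in>S. \<Sum>a\<in>S. g b a)"
    by (subst sum.swap) (simp add: sum_negf)
  finally have zero: "(\<Sum>a\<in>S. \<Sum>b\<in>S. g a b) = 0" by simp
  have "(\<Sum>a\<in>S. \<Sum>b\<in>V. g a b) = (\<Sum>a\<in>S. int n * of_bool (a = u))"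
    using unit_flowD(4)[OF g] S by (intro sum.cong) auto
  also have "\<dots> = int n"
    using fS S(2) by (simp add: of_bool_def if_distrib sum.delta cong: if_cong)
  finally have "(\<Sum>a\<in>S. \<Sum>b\<in>V. g a b) = int n" .
  moreover have "(\<Sum>a\<in>S. \<Sum>b\<in>V. g a b) = (\<Sum>a\<in>S. (\<Sum>b\<in>V - S. g a b) + (\<Sum>b\<in>S. g a b))"
    by (intro sum.cong refl sum.subset_diff[OF S(1) V])
  ultimately show ?thesis using zero by (simp add: sum.distrib)
qed

text \<open>Ford-Fulkerson: below value \<open>k\<close> the sink is reachable by residual arcs,
  since otherwise the reachable set would give a saturated cut with only \<open>n\<close>
  edges.\<close>

lemma unit_flow_exists:
  assumes V: "finite V" and E: "\<And>e. e \<in> E \<Longrightarrow> e \<subseteq> V \<and> card e = 2"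
    and uv: "u \<in> V" "v \<in> V" "u \<noteq> v"
    and k: "\<And>S. S \<subseteq> V \<Longrightarrow> u \<in> S \<Longrightarrow> v \<notin> S \<Longrightarrow> k \<le> card (cut E S)"
    and "n \<le> k"
  shows "\<exists>g. unit_flow V E u v n g"
  using \<open>n \<le> k\<close>
proof (induction n)
  case 0
  show ?case by (intro exI[of _ "\<lambda>_ _. 0"]) (simp add: unit_flow_def)
next
  case (Suc n)
  then obtain g where g: "unit_flow V E u v n g" by auto
  define r where "r = {(a, b). {a, b} \<in> E \<and> g a b < 1}"
  have rV: "r \<subseteq> V \<times> V" using E unfolding r_def by auto
  have "(u, v) \<in> r\<^sup>*"
  proof (rule ccontr)
    assume nr: "(u, v) \<notin> r\<^sup>*"
    define S where "S = {a. (u, a) \<in> r\<^sup>*}"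
    have SV: "S \<subseteq> V"
    proof
      fix a assume "a \<in> S"
      then have "(u, a) \<in> r\<^sup>*" unfolding S_def by simp
      then show "a \<in> V" using rV uv(1) by (cases rule: rtranclE) auto
    qed
    have S: "u \<in> S" "v \<notin> S" using nr unfolding S_def by auto
    define X where "X = {(a, b) \<in> S \<times> (V - S). {a, b} \<in> E}"
    \<comment> \<open>No residual arc leaves \<open>S\<close>, so every edge leaving
      \<open>S\<close> carries exactly one unit outwards.\<close>
    have gX: "g a b = of_bool ({a, b} \<in> E)" if "a \<in> S" "b \<in> V - S" for a b
    proof (cases "{a, b} \<in> E")
      case True
      have "(a, b) \<notin> r" using that rtrancl_into_rtrancl[of u a r b] unfolding S_def by blast
      then have "\<not> g a b < 1" using True unfolding r_def by blast
      moreover have "g a b \<le> 1" by (rule unit_flowD(2)[OF g])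
      ultimately show ?thesis using True by simp
    next
      case False
      then show ?thesis using unit_flowD(3)[OF g, of a b] by auto
    qed
    have fin: "finite (S \<times> (V - S))" using SV V finite_subset by blast
    have "int n = (\<Sum>a\<in>S. \<Sum>b\<in>V - S. of_bool ({a, b} \<in> E))"
      unfolding unit_flow_across_cut[OF g V SV S, symmetric] using gX by (intro sum.cong) auto
    also have "\<dots> = (\<Sum>(a, b)\<in>S \<times> (V - S). of_bool ({a, b} \<in> E))"
      by (rule sum.cartesian_product)
    also have "\<dots> = (\<Sum>x\<in>S \<times> (V - S). of_bool (x \<in> X))"
      unfolding X_def by (intro sum.cong) auto
    also have "\<dots> = int (card ((S \<times> (V - S)) \<inter> X))"
      using fin by (simp add: of_bool_def sum.If_cases)
    also have "(S \<times> (V - S)) \<inter> X = X" unfolding X_def by auto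
    finally have "n = card X" by simp
    moreover have "cut E S \<subseteq> (\<lambda>(a, b). {a, b}) ` X"
    proof
      fix e assume e: "e \<in> cut E S"
      then obtain a b where ab: "a \<in> e \<inter> S" "b \<in> e - S" unfolding cut_def by blast
      have "e \<subseteq> V" "card e = 2" using e E unfolding cut_def by auto
      then have "e = {a, b}" using ab by (auto simp: card_2_iff)
      then show "e \<in> (\<lambda>(a, b). {a, b}) ` X"
        using ab e \<open>e \<subseteq> V\<close> unfolding X_def cut_def by (intro image_eqI[of _ _ "(a, b)"]) auto
    qed
    moreover have "finite X" using fin unfolding X_def by (rule rev_finite_subset) auto
    ultimately have "card (cut E S) \<le> n"
      by (metis card_image_le card_mono finite_imageI le_trans)
    then show False using k[OF SV S] Suc.prems by linarith
  qed
  then obtain p where p: "p \<noteq> []" "distinct p" "hd p = u" "last p = v" "arcs p \<subseteq> r"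
    using rtrancl_imp_distinct_list by metis
  have "set p \<subseteq> V" using set_subset_if_arcs[OF subset_trans[OF p(5) rV] p(1)] p(3) uv(1) by simp
  then show ?case using unit_flow_add_path[OF g V p(1-4)] p(5) unfolding r_def by blast
qed

text \<open>A positive value forces a path of full arcs from \<open>u\<close> to \<open>v\<close>;
  otherwise the net flow out of the set reachable from \<open>u\<close> would be at most zero.
  Peeling off the path lowers the value by one.\<close>

lemma unit_flow_decompose:
  assumes V: "finite V" and E: "\<Union>E \<subseteq> V"
    and uv: "u \<in> V" "v \<in> V" "u \<noteq> v" and "unit_flow V E u v n g"
  shows "\<exists>P. finite P \<and> card P = n \<and>
    (\<forall>p\<in>P. p \<noteq> [] \<and> distinct p \<and> hd p = u \<and> last p = v \<and> set p \<subseteq> V \<and> arcs p \<subseteq> {(a, b). g a b = 1}) \<and>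
    pairwise (\<lambda>p q. disjnt (path_edges p) (path_edges q)) P"
  using assms(6)
proof (induction n arbitrary: g)
  case 0
  show ?case by (intro exI[of _ "{}"]) simp
next
  case (Suc n)
  note g = Suc.prems
  define r where "r = {(a, b). g a b = 1}"
  have rE: "{a, b} \<in> E" if "(a, b) \<in> r" for a b
    using that unit_flowD(3)[OF g, of a b] unfolding r_def by auto
  then have rV: "r \<subseteq> V \<times> V" using E by auto
  have "(u, v) \<in> r\<^sup>*"
  proof (rule ccontr)
    assume nr: "(u, v) \<notin> r\<^sup>*"
    define S where "S = {a. (u, a) \<in> r\<^sup>*}"
    have SV: "S \<subseteq> V"
    proof
      fix a assume "a \<in> S"
      then have "(u, a) \<in> r\<^sup>*" unfolding S_def by simp
      then show "a \<in> V" using rV uv(1) by (cases rule: rtranclE) auto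
    qed
    have S: "u \<in> S" "v \<notin> S" using nr unfolding S_def by auto
    have "g a b \<le> 0" if "a \<in> S" "b \<in> V - S" for a b
    proof -
      have "(a, b) \<notin> r" using that rtrancl_into_rtrancl[of u a r b] unfolding S_def by blast
      moreover have "g a b \<le> 1" by (rule unit_flowD(2)[OF g])
      ultimately show ?thesis unfolding r_def by auto
    qed
    then have "(\<Sum>a\<in>S. \<Sum>b\<in>V - S. g a b) \<le> 0" by (intro sum_nonpos) auto
    then show False using unit_flow_across_cut[OF g V SV S] by simp
  qed
  then obtain p where p: "p \<noteq> []" "distinct p" "hd p = u" "last p = v" "arcs p \<subseteq> r"
    using rtrancl_imp_distinct_list by metis
  have pV: "set p \<subseteq> V" using set_subset_if_arcs[OF subset_trans[OF p(5) rV] p(1)] p(3) uv(1) by simp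
  note rem = unit_flow_remove_path[OF g V p(1-4) pV p(5)[unfolded r_def]]
  obtain P where P: "finite P" "card P = n"
    "\<And>q. q \<in> P \<Longrightarrow> q \<noteq> [] \<and> distinct q \<and> hd q = u \<and> last q = v \<and> set q \<subseteq> V \<and>
       arcs q \<subseteq> {(a, b). g a b - path_flow p a b = 1}"
    "pairwise (\<lambda>p q. disjnt (path_edges p) (path_edges q)) P"
    using Suc.IH[OF rem(1)] by blast
  have arcs: "g a b = 1 \<and> (a, b) \<notin> arcs p \<and> (b, a) \<notin> arcs p" if "q \<in> P" "(a, b) \<in> arcs q" for q a b
    using rem(2) P(3)[OF that(1)] that(2) by blast
  have dis: "disjnt (path_edges p) (path_edges q)" if "q \<in> P" for q
    using arcs[OF that] unfolding disjnt_def path_edges_eq_arcs by (fastforce simp: doubleton_eq_iff)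
  \<comment> \<open>A path with an edge is not disjoint from itself, so \<open>p\<close> is new and
    the number of paths rises by one.\<close>
  have "path_edges p \<noteq> {}"
    using path_crosses_cut[of p "{u}"] p(1,3,4) uv(3) by auto
  then have "p \<notin> P" using dis unfolding disjnt_def by blast
  then show ?case
    using P p pV arcs dis unfolding r_def
    by (intro exI[of _ "insert p P"]) (auto simp: pairwise_insert disjnt_sym)
qed

text \<open>The hard half of Menger: the cut condition gives an integral flow of value
  \<open>k\<close>, which splits into unit paths.\<close>

theorem edge_menger:
  assumes G: "simple_graph G" and uv: "u \<in> verts G" "v \<in> verts G" "u \<noteq> v"
    and k: "\<And>S. S \<subseteq> verts G \<Longrightarrow> u \<in> S \<Longrightarrow> v \<notin> S \<Longrightarrow> k \<le> card (cut (edges G) S)"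
  shows "\<exists>P. edge_disjoint_paths G u v P \<and> card P = k"
proof -
  have V: "finite (verts G)" and E: "\<And>e. e \<in> edges G \<Longrightarrow> e \<subseteq> verts G \<and> card e = 2"
    using G unfolding simple_graph_def by auto
  obtain g where g: "unit_flow (verts G) (edges G) u v k g"
    using unit_flow_exists[OF V E uv k] by blast
  have "{a, b} \<in> edges G" if "g a b = 1" for a b
    using unit_flowD(3)[OF g, of a b] that by auto
  then have sub: "path_edges p \<subseteq> edges G" if "arcs p \<subseteq> {(a, b). g a b = 1}" for p
    using that unfolding path_edges_eq_arcs by auto
  have E': "\<Union>(edges G) \<subseteq> verts G" using E by blast
  obtain P where P: "finite P" "card P = k"
    "\<forall>p\<in>P. p \<noteq> [] \<and> distinct p \<and> hd p = u \<and> last p = v \<and> set p \<subseteq> verts G \<and>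
      arcs p \<subseteq> {(a, b). g a b = 1}"
    "pairwise (\<lambda>p q. disjnt (path_edges p) (path_edges q)) P"
    using unit_flow_decompose[OF V E' uv g] by (elim exE conjE)
  have "is_path G u v p" if "p \<in> P" for p
    using bspec[OF P(3) that] sub[of p] unfolding is_path_def by simp
  then show ?thesis
    using P(1,2,4) unfolding edge_disjoint_paths_def by blast
qed

section \<open>Colorings\<close>

definition color_class :: "'a ugraph \<Rightarrow> ('a set \<Rightarrow> nat) \<Rightarrow> nat \<Rightarrow> 'a set set" where
  "color_class G c i = {e \<in> edges G. c e = i}"

text \<open>By Menger this is \<open>k\<close>-edge-connection of \<open>u\<close> and \<open>v\<close>; in terms of cuts it is visibly transitive
  and monotone in \<open>F\<close>.\<close>

definition linked :: "nat \<Rightarrow> 'a set set \<Rightarrow> 'a \<Rightarrow> 'a \<Rightarrow> bool" where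
  "linked k F u v \<longleftrightarrow> (\<forall>S. (u \<in> S \<longleftrightarrow> v \<notin> S) \<longrightarrow> k \<le> card (cut F S))"

lemma linked_if_paths:
  assumes "edge_disjoint_paths G u v P" "k \<le> card P" "finite F" "\<And>p. p \<in> P \<Longrightarrow> path_edges p \<subseteq> F"
  shows "linked k F u v"
  unfolding linked_def
proof (intro allI impI)
  fix S assume S: "u \<in> S \<longleftrightarrow> v \<notin> S"
  show "k \<le> card (cut F S)"
  proof (cases "u \<in> S")
    case True
    then show ?thesis using card_paths_le_card_cut[OF assms(1,3,4)] S assms(2) by fastforce
  next
    case False
    \<comment> \<open>The complement of \<open>S\<close> has the same cut and contains
      \<open>u\<close>.\<close>
    have "card P \<le> card {e \<in> F. e \<inter> - S \<noteq> {} \<and> \<not> e \<subseteq> - S}"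
      using card_paths_le_card_cut[OF assms(1,3,4), of "- S"] S False unfolding cut_def by simp
    also have "{e \<in> F. e \<inter> - S \<noteq> {} \<and> \<not> e \<subseteq> - S} = cut F S" unfolding cut_def by blast
    finally show ?thesis using assms(2) by simp
  qed
qed

text \<open>Connectedness of the graph on \<open>V\<close> formed by the relations
  \<open>R i\<close> with \<open>i\<close> in \<open>I\<close>, phrased by cuts so that failure
  directly yields a cut.\<close>

definition spans :: "'a set \<Rightarrow> (nat \<Rightarrow> 'a \<Rightarrow> 'a \<Rightarrow> bool) \<Rightarrow> nat set \<Rightarrow> bool" where
  "spans V R I \<longleftrightarrow> (\<forall>S. V \<inter> S \<noteq> {} \<longrightarrow> V - S \<noteq> {} \<longrightarrow>
     (\<exists>i\<in>I. \<exists>x\<in>V \<inter> S. \<exists>y\<in>V - S. R i x y))"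

lemma minimal_spanning_subset:
  assumes "finite C" "spans V R C"
  obtains I where "I \<subseteq> C" "spans V R I" "\<And>i. i \<in> I \<Longrightarrow> \<not> spans V R (I - {i})"
proof -
  have "\<exists>I. (I \<subseteq> C \<and> spans V R I) \<and> (\<forall>J. J \<subseteq> C \<and> spans V R J \<longrightarrow> card I \<le> card J)"
    using ex_has_least_nat[of "\<lambda>I. I \<subseteq> C \<and> spans V R I" C card] assms(2) by blast
  then obtain I where I: "I \<subseteq> C" "spans V R I" "\<And>J. J \<subseteq> C \<Longrightarrow> spans V R J \<Longrightarrow> card I \<le> card J"
    by blast
  have "\<not> spans V R (I - {i})" if "i \<in> I" for i
  proof
    assume "spans V R (I - {i})"
    then have "card I \<le> card (I - {i})" using I(1) by (intro I(3)) auto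
    then show False
      using that finite_subset[OF I(1) assms(1)] by (metis card_Diff1_less leD)
  qed
  then show thesis using that I by blast
qed

section \<open>Upper bound on the number of colors\<close>

lemma finite_edges: "simple_graph G \<Longrightarrow> finite (edges G)"
  unfolding simple_graph_def by (meson PowI finite_Pow_iff finite_subset subsetI)

text \<open>Every cut of the vertex set is crossed by a link of some color in \<open>I\<close>, and
  that color alone puts \<open>k\<close> edges into the cut; Menger then gives the paths.\<close>

lemma edge_connected_Union_color_classes:
  assumes G: "simple_graph G" "2 \<le> card (verts G)"
    and I: "spans (verts G) (\<lambda>i. linked k (color_class G c i)) I"
  shows "edge_connected k \<lparr>verts = verts G, edges = {e \<in> edges G. c e \<in> I}\<rparr>"
    (is "edge_connected k ?H")
  unfolding edge_connected_def
proof (intro conjI ballI impI)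
  show H: "simple_graph ?H" using G(1) unfolding simple_graph_def by simp
  show "2 \<le> card (verts ?H)" using G(2) by simp
  have finE: "finite (edges G)" using G(1) by (rule finite_edges)
  fix u v assume uv: "u \<in> verts ?H" "v \<in> verts ?H" "u \<noteq> v"
  have "k \<le> card (cut (edges ?H) S)" if S: "S \<subseteq> verts ?H" "u \<in> S" "v \<notin> S" for S
  proof -
    have "verts G \<inter> S \<noteq> {}" "verts G - S \<noteq> {}" using uv S by auto
    then obtain i x y where i: "i \<in> I" "x \<in> S" "y \<notin> S" "linked k (color_class G c i) x y"
      using I unfolding spans_def by blast
    then have "k \<le> card (cut (color_class G c i) S)" unfolding linked_def by blast
    also have "\<dots> \<le> card (cut (edges ?H) S)"
      using i(1) finE by (intro card_mono finite_cut) (auto simp: cut_def color_class_def)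
    finally show ?thesis .
  qed
  then show "\<exists>P. edge_disjoint_paths ?H u v P \<and> k \<le> card P"
    using edge_menger[OF H uv, of k] by auto
qed

lemma umc_coloring_color_bound:
  assumes k: "2 \<le> k" and G: "simple_graph G" "2 \<le> card (verts G)" and c: "umc_coloring k G c"
  obtains I where "edge_connected k \<lparr>verts = verts G, edges = {e \<in> edges G. c e \<in> I}\<rparr>"
    and "card (c ` edges G) + card {e \<in> edges G. c e \<in> I} \<le> card (edges G) + 1"
proof -
  define V E C where "V = verts G" and "E = edges G" and "C = c ` E"
  define F where "F = color_class G c"
  have F: "F i = {e \<in> E. c e = i}" for i unfolding F_def E_def color_class_def ..
  have V: "finite V" and E: "\<And>e. e \<in> E \<Longrightarrow> e \<subseteq> V \<and> card e = 2"
    using G unfolding V_def E_def simple_graph_def by auto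
  have finE: "finite E" unfolding E_def using G(1) by (rule finite_edges)
  have finC: "finite C" unfolding C_def using finE by simp
  have link: "\<exists>i\<in>C. linked k (F i) u v" if uv: "u \<in> V" "v \<in> V" "u \<noteq> v" for u v
  proof -
    obtain P i where P: "edge_disjoint_paths G u v P" "k \<le> card P" "\<forall>p\<in>P. \<forall>e\<in>path_edges p. c e = i"
      using c uv unfolding umc_coloring_def V_def by blast
    have path: "is_path G u v p" if "p \<in> P" for p
      using P(1) that unfolding edge_disjoint_paths_def by blast
    have sub: "path_edges p \<subseteq> F i" if "p \<in> P" for p
      using path[OF that] P(3) that unfolding F E_def is_path_def by blast
    have "P \<noteq> {}" using P(2) k by auto
    then obtain p where p: "p \<in> P" by blast
    obtain e where "e \<in> path_edges p"
      using path_crosses_cut[of p "{u}"] path[OF p] uv(3) unfolding is_path_def by auto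
    then have "i \<in> C" using sub[OF p] unfolding F C_def by blast
    moreover have "linked k (F i) u v"
      using linked_if_paths[OF P(1,2) _ sub] finE unfolding F by simp
    ultimately show ?thesis by blast
  qed
  have "spans V (\<lambda>i. linked k (F i)) C" unfolding spans_def using link by blast
  then obtain I where I: "I \<subseteq> C" "spans V (\<lambda>i. linked k (F i)) I"
    and min: "\<And>i. i \<in> I \<Longrightarrow> \<not> spans V (\<lambda>i. linked k (F i)) (I - {i})"
    using minimal_spanning_subset[OF finC] by blast
  have finI: "finite I" using I(1) finC finite_subset by blast
  have "\<exists>f. \<forall>i\<in>C. f i \<in> F i" by (rule bchoice) (auto simp: C_def F)
  then obtain f where f: "\<And>i. i \<in> C \<Longrightarrow> f i \<in> E" "\<And>i. i \<in> C \<Longrightarrow> c (f i) = i" unfolding F by blast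
  \<comment> \<open>One representative per color outside \<open>I\<close> is dropped, so
    \<open>card W\<close> is the number of edges with colors outside \<open>I\<close> minus
    \<open>card C - card I\<close>. The claimed bound thus reduces to
    \<open>card I \<le> card W + 1\<close>.\<close>
  define W where "W = {e \<in> E. c e \<notin> I} - f ` (C - I)"
  have "card W = card {e \<in> E. c e \<notin> I} - card (f ` (C - I))"
    unfolding W_def using f finC finE by (intro card_Diff_subset) auto
  moreover have "card (f ` (C - I)) \<le> card {e \<in> E. c e \<notin> I}"
    using f finE by (intro card_mono) auto
  moreover have "card (f ` (C - I)) = card C - card I"
  proof -
    have "inj_on f C" by (rule inj_on_inverseI[of _ c]) (rule f(2))
    then have "card (f ` (C - I)) = card (C - I)" by (intro card_image) (auto intro: inj_on_subset)
    then show ?thesis using finI I(1) by (simp add: card_Diff_subset)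
  qed
  moreover have "card I \<le> card C" using I(1) finC by (rule card_mono[rotated])
  moreover have "card {e \<in> E. c e \<in> I} + card {e \<in> E. c e \<notin> I} = card E"
  proof -
    have "{e \<in> E. c e \<in> I} \<union> {e \<in> E. c e \<notin> I} = E" by blast
    then show ?thesis using finE by (subst card_Un_disjoint[symmetric]) auto
  qed
  moreover have "card I \<le> card W + 1"
  proof -
    \<comment> \<open>Packages a cut showing that \<open>I - {i}\<close> does not span, so that one
      cut \<open>S i\<close> can be chosen for each color.\<close>
    define Q where "Q i S \<longleftrightarrow> \<not> (V \<inter> S \<noteq> {} \<longrightarrow> V - S \<noteq> {} \<longrightarrow>
        (\<exists>j\<in>I - {i}. \<exists>x\<in>V \<inter> S. \<exists>y\<in>V - S. linked k (F j) x y))" for i S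
    have "\<exists>S. Q i S" if "i \<in> I" for i
      using min[OF that] unfolding spans_def Q_def by (simp only: not_all)
    then obtain S where Q: "\<forall>i\<in>I. Q i (S i)" using bchoice[of I Q] by blast
    have S: "V \<inter> S i \<noteq> {}" "V - S i \<noteq> {}" if "i \<in> I" for i
      using bspec[OF Q that] unfolding Q_def by auto
    have S_sep: "\<not> linked k (F j) x y"
      if "i \<in> I" "j \<in> I" "j \<noteq> i" "x \<in> V \<inter> S i" "y \<in> V - S i" for i j x y
      using bspec[OF Q that(1)] that(2-5) unfolding Q_def by blast
    have linked_sym: "linked k X x y \<Longrightarrow> linked k X y x" for X x y unfolding linked_def by blast
    have S_eq: "x \<in> S i \<longleftrightarrow> y \<in> S i"
      if "i \<in> I" "j \<in> I" "j \<noteq> i" "x \<in> V" "y \<in> V" "linked k (F j) x y" for i j x y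
      using S_sep[OF that(1-3), of x y] S_sep[OF that(1-3), of y x] that(4-6) linked_sym[OF that(6)]
      by blast
    show ?thesis
    proof (rule critical_family_card_le[OF finI V, where S = S])
      show "V \<noteq> {}" using G(2) unfolding V_def by auto
      show "finite W" unfolding W_def using finE by simp
    next
      fix j assume j: "j \<in> I"
      \<comment> \<open>As \<open>I\<close> spans, some link crosses \<open>S j\<close>. Its color
        can only be \<open>j\<close>, so its ends are not separated by any other
        \<open>S l\<close>.\<close>
      obtain i x y where ixy: "i \<in> I" "x \<in> V \<inter> S j" "y \<in> V - S j" "linked k (F i) x y"
        using I(2) S[OF j] unfolding spans_def by blast
      then have "i = j" using S_sep[OF j, of i x y] by blast
      then have "(x \<in> S l \<longleftrightarrow> y \<notin> S l) \<longleftrightarrow> l = j" if "l \<in> I" for l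
        using S_eq[OF that j, of x y] ixy by blast
      then show "\<exists>x\<in>V. \<exists>y\<in>V. \<forall>l\<in>I. (x \<in> S l \<longleftrightarrow> y \<notin> S l) \<longleftrightarrow> l = j"
        using ixy(2,3) by blast
    next
      fix T x y assume xy: "x \<in> V \<inter> T" "y \<in> V - T" and far: "far {j \<in> I. x \<in> S j} {j \<in> I. y \<in> S j}"
      then obtain i where i: "i \<in> C" "linked k (F i) x y" using link[of x y] by blast
      \<comment> \<open>A link with color in \<open>I\<close> crosses at most the cut of its own
        color, so the traces of its ends are never far.\<close>
      have "i \<notin> I"
      proof
        assume "i \<in> I"
        then have "\<And>l. l \<in> I \<Longrightarrow> l \<noteq> i \<Longrightarrow> x \<in> S l \<longleftrightarrow> y \<in> S l" using S_eq[of _ i x y] i(2) xy by blast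
        then show False using far unfolding far_def by blast
      qed
      \<comment> \<open>Here \<open>k \<ge> 2\<close> matters: of two edges of color
        \<open>i\<close> across \<open>T\<close>, at most one is the dropped representative.\<close>
      have "2 \<le> card (cut (F i) T)" using i(2) xy k unfolding linked_def by (meson DiffD2 IntD2 le_trans)
      then obtain e where e: "e \<in> cut (F i) T" "e \<noteq> f i"
        by (metis One_nat_def card_le_Suc0_iff_eq card.infinite le_trans not_less_eq_eq numeral_2_eq_2 zero_le)
      then have "e \<in> E" "c e = i" unfolding cut_def F by auto
      then have "e \<in> W" unfolding W_def using e(2) f(2) \<open>i \<notin> I\<close> by auto
      obtain a b where ab: "a \<in> e \<inter> T" "b \<in> e - T" using e(1) unfolding cut_def by blast
      have "e \<subseteq> V" "card e = 2" using E \<open>e \<in> E\<close> by auto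
      then have "e = {a, b}" using ab by (auto simp: card_2_iff)
      then show "\<exists>a\<in>V \<inter> T. \<exists>b\<in>V - T. {a, b} \<in> W" using ab \<open>e \<subseteq> V\<close> \<open>e \<in> W\<close> by blast
    qed
  qed
  ultimately have "card C + card {e \<in> E. c e \<in> I} \<le> card E + 1" by linarith
  moreover have "edge_connected k \<lparr>verts = verts G, edges = {e \<in> edges G. c e \<in> I}\<rparr>"
    using edge_connected_Union_color_classes[OF G] I(2) unfolding F_def V_def by blast
  ultimately show thesis using that unfolding C_def E_def by blast
qed

section \<open>Lower bound and conclusion\<close>

lemma umc_coloring_if_edge_connected_subgraph:
  assumes H: "edge_connected k H" "verts H = verts G" "edges H \<subseteq> edges G"
    and c: "\<And>e. e \<in> edges H \<Longrightarrow> c e = i"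
  shows "umc_coloring k G c"
  unfolding umc_coloring_def
proof (intro ballI impI)
  fix u v assume "u \<in> verts G" "v \<in> verts G" "u \<noteq> v"
  then obtain P where P: "edge_disjoint_paths H u v P" "k \<le> card P"
    using H(1) unfolding edge_connected_def H(2) by blast
  have path: "is_path H u v p" if "p \<in> P" for p
    using P(1) that unfolding edge_disjoint_paths_def by blast
  then have "is_path G u v p" if "p \<in> P" for p
    using that H(2,3) unfolding is_path_def by blast
  then have "edge_disjoint_paths G u v P" using P(1) unfolding edge_disjoint_paths_def by blast
  moreover have "\<forall>p\<in>P. \<forall>e\<in>path_edges p. c e = i"
    using path c unfolding is_path_def by blast
  ultimately show "\<exists>P col. edge_disjoint_paths G u v P \<and> k \<le> card P \<and>
      (\<forall>p\<in>P. \<forall>e\<in>path_edges p. c e = col)"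
    using P(2) by blast
qed

text \<open>Ensures that the color reserved for \<open>H\<close> occurs, which accounts for the
  additive one.\<close>

lemma edges_nonempty_if_edge_connected:
  assumes "edge_connected k H" "0 < k"
  shows "edges H \<noteq> {}"
proof -
  have "\<not> card (verts H) \<le> Suc 0" "finite (verts H)"
    using assms(1) unfolding edge_connected_def simple_graph_def by auto
  then obtain u v where uv: "u \<in> verts H" "v \<in> verts H" "u \<noteq> v"
    using card_le_Suc0_iff_eq by blast
  then obtain P where P: "edge_disjoint_paths H u v P" "k \<le> card P"
    using assms(1) unfolding edge_connected_def by auto
  then have "P \<noteq> {}" using assms(2) by auto
  then obtain p where "is_path H u v p" using P(1) unfolding edge_disjoint_paths_def by blast
  then show ?thesis
    using path_crosses_cut[of p "{u}"] uv(3) unfolding is_path_def by auto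
qed

theorem theorem3p1:
  fixes k :: nat and G H :: "'a ugraph"
  assumes "k \<ge> 2"
    and "edge_connected k G"
    and "min_edge_connected_spanning_subgraph k G H"
  shows "int (umc k G) = int (card (edges G)) - int (card (edges H)) + 1"
proof -
  have G: "simple_graph G" "2 \<le> card (verts G)" using assms(2) unfolding edge_connected_def by auto
  have finE: "finite (edges G)" using G(1) by (rule finite_edges)
  have H: "verts H = verts G" "edges H \<subseteq> edges G" "edge_connected k H"
    and H_min: "\<And>H'. verts H' = verts G \<Longrightarrow> edges H' \<subseteq> edges G \<Longrightarrow> edge_connected k H' \<Longrightarrow>
      card (edges H) \<le> card (edges H')"
    using assms(3)
    unfolding min_edge_connected_spanning_subgraph_def is_arg_min_def spanning_subgraph_def
    by (auto simp: not_less)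
  let ?A = "{card (c ` edges G) | c. umc_coloring k G c}"
  let ?m = "card (edges G - edges H) + 1"
  have card_diff: "card (edges G - edges H) + card (edges H) = card (edges G)"
    using H(2) finE by (metis card_Diff_subset card_mono finite_subset le_add_diff_inverse2)
  have upper: "n \<le> ?m" if n: "n \<in> ?A" for n
  proof -
    obtain c where c: "n = card (c ` edges G)" "umc_coloring k G c" using n by blast
    obtain I where I: "edge_connected k \<lparr>verts = verts G, edges = {e \<in> edges G. c e \<in> I}\<rparr>"
      "card (c ` edges G) + card {e \<in> edges G. c e \<in> I} \<le> card (edges G) + 1"
      using umc_coloring_color_bound[OF assms(1) G c(2)] by blast
    have "card (edges H) \<le> card {e \<in> edges G. c e \<in> I}" using H_min[OF _ _ I(1)] by auto
    then show ?thesis using I(2) c(1) card_diff by linarith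
  qed
  have "?m \<in> ?A"
  proof -
    obtain g :: "'a set \<Rightarrow> nat" where g: "inj_on g (edges G)"
      using finite_imp_inj_to_nat_seg[OF finE] by blast
    \<comment> \<open>\<open>H\<close> gets color 0, and \<open>Suc\<close> keeps the distinct
      colors of the other edges away from it.\<close>
    define c where "c e = (if e \<in> edges H then 0 else Suc (g e))" for e
    have "c ` edges G = c ` edges H \<union> c ` (edges G - edges H)" using H(2) by blast
    also have "c ` edges H = {0}"
      using edges_nonempty_if_edge_connected[OF H(3)] assms(1) unfolding c_def by auto
    finally have "c ` edges G = insert 0 (c ` (edges G - edges H))" by simp
    moreover have "0 \<notin> c ` (edges G - edges H)" unfolding c_def by auto
    moreover have "inj_on c (edges G - edges H)"
      using g unfolding c_def inj_on_def by auto
    ultimately have "card (c ` edges G) = ?m" using finE by (simp add: card_image)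
    moreover have "umc_coloring k G c"
      using umc_coloring_if_edge_connected_subgraph[OF H(3,1,2), of c 0] unfolding c_def by simp
    ultimately show ?thesis by (metis (mono_tags, lifting) mem_Collect_eq)
  qed
  moreover have "finite ?A" using upper by (meson finite_nat_set_iff_bounded_le)
  ultimately have "umc k G = ?m" unfolding umc_def using upper by (intro Max_eqI) auto
  then show ?thesis using card_diff by linarith
qed

end
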